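(* Let $n\ge 1$ and let $\gamma,\eta\in\mathrm{PSL}_2\mathbb{R}$ be two loxodromic elements. Assume that the fixed points $\gamma^+,\gamma^-,\eta^+,\eta^-\in\partial\mathbb{H}^2$ are pairwise distinct, and let $t=[\eta^-,\eta^+;\gamma^+,\gamma^-]$ be the cross-ratio of their attracting and repelling fixed points. Then $$B\big(x^0(\sigma_{4n-1}(\eta)),\,x^0(\sigma_{4n-1}(\gamma))\big)=\frac{1}{(t-1)^{2n-1}}\sum_{j=0}^{2n-1}\binom{2n-1}{j}^2t^j .$$
   Context: An element of $\mathrm{PSL}_2\mathbb{R}$ is loxodromic if a lift to $\mathrm{SL}_2\mathbb{R}$ has two distinct real eigenvalues; $\gamma^+$ and $\gamma^-$ denote its attracting and repelling fixed points in $\partial\mathbb{H}^2\cong\mathbb{RP}^1$. Here $\mathbb{RP}^1=\mathbb{R}\cup\{\infty\}$, the line spanned by $xe_1+ye_2$ corresponding to $x/y$, and $\mathrm{PSL}_2\mathbb{R}$ acts by Möbius transformations. The cross-ratio is $[z_1,z_2;z_3,z_4]:=\frac{z_3-z_1}{z_3-z_2}\cdot\frac{z_4-z_2}{z_4-z_1}$, so that $[t,1;0,\infty]=t$; it is $\mathrm{PSL}_2\mathbb{R}$-invariant. Fix the oriented basis $(e_1,e_2)$ of $\mathbb{R}^2$ and the area form $\omega$ with $\omega(e_1,e_2)=-\omega(e_2,e_1)=1$, $\omega(e_i,e_i)=0$. $\mathrm{Sym}^{4n-2}(\mathbb{R}^2)\cong\mathbb{R}^{4n-1}$ is the space of symmetric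 tensors in $(\mathbb{R}^2)^{\otimes(4n-2)}$. For $v_1,v_2\in\mathbb{R}^2$, $v_1^iv_2^{4n-2-i}$ denotes the sum of all tensors $v_{k_1}\otimes\cdots\otimes v_{k_{4n-2}}$ where exactly $i$ of the $k_j$ equal $1$ and the rest equal $2$. The irreducible representation $\sigma_{4n-1}$ of $\mathrm{PSL}_2\mathbb{R}$ on $\mathrm{Sym}^{4n-2}(\mathbb{R}^2)$ is induced by $\gamma\cdot e_1^ie_2^{4n-2-i}=(\gamma e_1)^i(\gamma e_2)^{4n-2-i}$. $B$ is the invariant symmetric bilinear form of signature $(2n,2n-1)$ on $\mathrm{Sym}^{4n-2}(\mathbb{R}^2)$ obtained by restricting the bilinear form defined on elementary tensors by $B(v_1\otimes\cdots\otimes v_{4n-2},w_1\otimes\cdots\otimes w_{4n-2})=-\prod_{i=1}^{4n-2}\omega(v_i,w_i)$. For $\gamma\in\mathrm{PSL}_2\mathbb{R}$ loxodromic with eigenvalues $|\lambda|>|\lambda^{-1}|$ and corresponding eigenvectors $v_1,v_2$ chosen so that $(v_1,v_2)$ is a positively oriented basis, the neutral vector is $$x^0(\sigma_{4n-1}(\gamma)):=\frac{v_1^{2n-1}v_2^{2n-1}}{B(v_1^{2n-1}v_2^{2n-1},v_1^{2n-1}v_2^{2n-1})^{1/2}}.$$ *)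

theory Defs
  imports "HOL-Analysis.Analysis" "HOL-Algebra.Coset"
begin

definition SL2R :: "(real^2^2) monoid" where
  "SL2R = \<lparr>carrier = {A. det A = 1}, mult = (**), one = mat 1\<rparr>"

text \<open>An element of \<open>PSL2R\<close> is a coset, that is, the set \<open>{A, - A}\<close> of its two lifts to \<open>SL2R\<close>.\<close>

definition PSL2R :: "(real^2^2) set monoid" where
  "PSL2R = SL2R Mod {mat 1, - mat 1}"

definition loxodromic :: "(real^2^2) set \<Rightarrow> bool" where
  "loxodromic \<gamma> \<longleftrightarrow> (\<exists>A\<in>\<gamma>. \<exists>l m :: real. l \<noteq> m \<and>
     (\<exists>v. v \<noteq> 0 \<and> A *v v = l *\<^sub>R v) \<and> (\<exists>w. w \<noteq> 0 \<and> A *v w = m *\<^sub>R w))"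

text \<open>The projective line is \<^typ>\<open>real option\<close>, with \<^term>\<open>None\<close> as the point at infinity; the line
  spanned by \<open>x e1 + y e2\<close> is the point \<open>x / y\<close>.\<close>

fun moebius :: "real^2^2 \<Rightarrow> real option \<Rightarrow> real option" where
  "moebius A None = (if A$2$1 = 0 then None else Some (A$1$1 / A$2$1))"
| "moebius A (Some x) =
     (if A$2$1 * x + A$2$2 = 0 then None
      else Some ((A$1$1 * x + A$1$2) / (A$2$1 * x + A$2$2)))"

definition PSL2R_act :: "(real^2^2) set \<Rightarrow> real option \<Rightarrow> real option" where
  "PSL2R_act \<gamma> z = (THE w. \<exists>A\<in>\<gamma>. w = moebius A z)"

abbreviation RP1 :: "real option topology" where
  "RP1 \<equiv> Alexandroff_compactification euclideanreal"

definition attracting_fixed_point :: "(real^2^2) set \<Rightarrow> real option \<Rightarrow> bool" where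
  "attracting_fixed_point \<gamma> p \<longleftrightarrow> PSL2R_act \<gamma> p = p \<and>
     (\<exists>U. openin RP1 U \<and> p \<in> U \<and>
       (\<forall>z\<in>U. limitin RP1 (\<lambda>k. (PSL2R_act \<gamma> ^^ k) z) p sequentially))"

definition attracting :: "(real^2^2) set \<Rightarrow> real option" where
  "attracting \<gamma> = (THE p. attracting_fixed_point \<gamma> p)"

definition repelling :: "(real^2^2) set \<Rightarrow> real option" where
  "repelling \<gamma> = (THE p. attracting_fixed_point (inv\<^bsub>PSL2R\<^esub> \<gamma>) p)"

text \<open>If one argument is infinite, the two factors containing it cancel in the limit. The last
  equation only concerns quadruples in which infinity is repeated.\<close>

fun cross_ratio :: "real option \<Rightarrow> real option \<Rightarrow> real option \<Rightarrow> real option \<Rightarrow> real" where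
  "cross_ratio (Some a) (Some b) (Some c) (Some d) = (c - a) / (c - b) * ((d - b) / (d - a))"
| "cross_ratio None (Some b) (Some c) (Some d) = (d - b) / (c - b)"
| "cross_ratio (Some a) None (Some c) (Some d) = (c - a) / (d - a)"
| "cross_ratio (Some a) (Some b) None (Some d) = (d - b) / (d - a)"
| "cross_ratio (Some a) (Some b) (Some c) None = (c - a) / (c - b)"
| "cross_ratio _ _ _ _ = undefined"

lemma cross_ratio_normalised: "cross_ratio (Some t) (Some 1) (Some 0) None = t"
  by simp

definition area_form :: "real^2 \<Rightarrow> real^2 \<Rightarrow> real" where
  "area_form v w = v$1 * w$2 - v$2 * w$1"

text \<open>The tensor power of \<open>R^2\<close> with factors indexed by a finite type \<open>'k\<close>: the coordinate at
  \<open>is\<close> is the coefficient of the elementary tensor of the basis vectors \<open>axis (is $ k) 1\<close>.\<close>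

type_synonym 'k tensor = "real ^ (2 ^ 'k)"

definition elementary :: "('k::finite \<Rightarrow> real^2) \<Rightarrow> 'k tensor" where
  "elementary v = (\<chi> is. \<Prod>k\<in>UNIV. v k $ (is $ k))"

definition sym_tensors :: "('k::finite) tensor set" where
  "sym_tensors = {T. \<forall>p is. p permutes UNIV \<longrightarrow> T $ (\<chi> k. is $ p k) = T $ is}"

text \<open>\<open>sym_monomial v w i\<close> is the symmetric tensor \<open>v^i w^(N - i)\<close>, where \<open>N = CARD('k)\<close>; the set
  \<open>S\<close> consists of the factors occupied by \<open>v\<close>.\<close>

definition sym_monomial :: "real^2 \<Rightarrow> real^2 \<Rightarrow> nat \<Rightarrow> ('k::finite) tensor" where
  "sym_monomial v w i = (\<Sum>S\<in>{S. card S = i}. elementary (\<lambda>k. if k \<in> S then v else w))"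

text \<open>The linear extension of \<open>e1^i e2^(N - i) \<mapsto> (A e1)^i (A e2)^(N - i)\<close>, where \<open>A\<close> is a lift
  of \<open>\<gamma>\<close>. It does not depend on the lift if \<open>N\<close> is even.\<close>

definition sym_rep :: "(real^2^2) set \<Rightarrow> ('k::finite) tensor \<Rightarrow> 'k tensor" where
  "sym_rep \<gamma> = (\<lambda>T\<in>sym_tensors. THE U. \<exists>A\<in>\<gamma>. \<exists>c :: nat \<Rightarrow> real.
     T = (\<Sum>i\<le>CARD('k). c i *\<^sub>R sym_monomial (axis 1 1) (axis 2 1) i) \<and>
     U = (\<Sum>i\<le>CARD('k). c i *\<^sub>R sym_monomial (A *v axis 1 1) (A *v axis 2 1) i))"

text \<open>The bilinear extension of the formula in \<open>tensor_form_elementary\<close> below from the basis of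
  elementary tensors.\<close>

definition tensor_form :: "('k::finite) tensor \<Rightarrow> 'k tensor \<Rightarrow> real" where
  "tensor_form S T = (\<Sum>is\<in>UNIV. \<Sum>js\<in>UNIV. S $ is * T $ js *
     - (\<Prod>k\<in>UNIV. area_form (axis (is $ k) 1) (axis (js $ k) 1)))"

text \<open>The vector depends only on \<open>g = sym_rep \<gamma>\<close>, since \<^term>\<open>sym_rep\<close> is faithful for
  \<open>CARD('k) = 4 * n - 2\<close>. Both lifts have the same eigenlines, and rescaling \<open>v1\<close>, \<open>v2\<close> while keeping
  the orientation multiplies \<open>u\<close> by a positive factor.\<close>

definition neutral_vector :: "nat \<Rightarrow> (('k::finite) tensor \<Rightarrow> 'k tensor) \<Rightarrow> 'k tensor" where
  "neutral_vector n g = (THE x. \<exists>\<gamma>\<in>carrier PSL2R. loxodromic \<gamma> \<and> g = sym_rep \<gamma> \<and>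
     (\<exists>A\<in>\<gamma>. \<exists>l v1 v2. \<bar>l\<bar> > \<bar>inverse l\<bar> \<and> A *v v1 = l *\<^sub>R v1 \<and> A *v v2 = inverse l *\<^sub>R v2 \<and>
        area_form v1 v2 > 0 \<and>
        (let u = sym_monomial v1 v2 (2 * n - 1) in x = u /\<^sub>R sqrt (tensor_form u u))))"

lemma SL2R_group: "group SL2R"
proof (rule groupI)
  fix A assume "A \<in> carrier SL2R"
  then have d: "det A = 1" by (simp add: SL2R_def)
  then obtain B where B: "B ** A = mat 1"
    using invertible_det_nz[of A] unfolding invertible_def by auto
  then have "det B = 1" using det_mul[of B A] d by simp
  with B show "\<exists>B\<in>carrier SL2R. B \<otimes>\<^bsub>SL2R\<^esub> A = \<one>\<^bsub>SL2R\<^esub>" by (auto simp: SL2R_def)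
qed (auto simp: SL2R_def det_mul matrix_mul_assoc)

lemma matrix_neg [simp]:
  fixes A B :: "real^2^2"
  shows "(- A) ** B = - (A ** B)" "A ** (- B) = - (A ** B)"
  by (simp_all add: matrix_matrix_mult_def vec_eq_iff sum_negf)

lemma det_neg2 [simp]: "det (- A) = det (A :: real^2^2)"
  by (simp add: det_2)

lemma carrier_PSL2R: "\<gamma> \<in> carrier PSL2R \<longleftrightarrow> (\<exists>A. det A = 1 \<and> \<gamma> = {A, - A})"
  by (auto simp: PSL2R_def carrier_FactGroup r_coset_def SL2R_def image_iff)

lemma PSL2R_group: "group PSL2R"
proof -
  interpret group SL2R by (rule SL2R_group)
  have inv_neg: "inv\<^bsub>SL2R\<^esub> (- mat 1) = - mat 1"
    by (rule inv_equality) (auto simp: SL2R_def)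
  have "subgroup {mat 1, - mat 1} SL2R"
    using inv_neg inv_one by (intro subgroupI) (auto simp: SL2R_def)
  then have "{mat 1, - mat 1} \<lhd> SL2R"
    by (rule normalI) (auto simp: r_coset_def l_coset_def SL2R_def)
  then show ?thesis unfolding PSL2R_def by (rule normal.factorgroup_is_group)
qed

lemma tensor_form_bilinear: "bilinear tensor_form"
  unfolding bilinear_def
  by (auto intro!: linearI
      simp: tensor_form_def algebra_simps sum.distrib sum_distrib_left sum_negf sum_subtractf)

lemma area_form_axis:
  "area_form v w = (\<Sum>i\<in>UNIV. \<Sum>j\<in>UNIV. v $ i * w $ j * area_form (axis i 1) (axis j 1))"
  by (simp add: area_form_def sum_2 axis_def)

lemma bij_vec: "bij_betw vec_nth (UNIV :: ('a ^ 'k::finite) set) (PiE UNIV (\<lambda>_. UNIV))"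
  by (rule bij_betwI[where g = vec_lambda]) (auto simp: vec_lambda_inverse)

lemma prod_sum_vec:
  "(\<Prod>k\<in>(UNIV::'k::finite set). \<Sum>i\<in>UNIV. f k (i::2)) = (\<Sum>is\<in>UNIV. \<Prod>k\<in>UNIV. (f k (is $ k) :: real))"
proof -
  have "(\<Prod>k\<in>(UNIV::'k set). \<Sum>i\<in>UNIV. f k i) = (\<Sum>g\<in>PiE UNIV (\<lambda>_. UNIV). \<Prod>k\<in>UNIV. f k (g k))"
    by (rule prod_sum_PiE) auto
  also have "\<dots> = (\<Sum>is\<in>UNIV. \<Prod>k\<in>UNIV. f k (is $ k))"
    by (rule sum.reindex_bij_betw[OF bij_vec, symmetric])
  finally show ?thesis .
qed

lemma tensor_form_elementary:
  "tensor_form (elementary v) (elementary w) = - (\<Prod>k\<in>UNIV. area_form (v k) (w k))"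
proof -
  have "(\<Prod>k\<in>UNIV. area_form (v k) (w k)) =
     (\<Sum>is\<in>UNIV. \<Prod>k\<in>UNIV. \<Sum>j\<in>UNIV. v k $ (is $ k) * w k $ j * area_form (axis (is $ k) 1) (axis j 1))"
    by (subst area_form_axis) (rule prod_sum_vec)
  also have "\<dots> = (\<Sum>is\<in>UNIV. \<Sum>js\<in>UNIV. elementary v $ is * elementary w $ js *
     (\<Prod>k\<in>UNIV. area_form (axis (is $ k) 1) (axis (js $ k) 1)))"
    by (simp add: prod_sum_vec elementary_def prod.distrib)
  finally show ?thesis by (simp add: tensor_form_def sum_negf)
qed

lemma sym_monomial_sym: "(sym_monomial v w i :: ('k::finite) tensor) \<in> sym_tensors"
proof -
  { fix p :: "'k \<Rightarrow> 'k" and "is" :: "2^'k" assume p: "p permutes UNIV"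
    have bp: "bij p" using p permutes_bij by blast
    have "(\<Sum>S | card S = i. \<Prod>k\<in>UNIV. (if k \<in> S then v else w) $ (is $ p k)) =
      (\<Sum>S | card S = i. \<Prod>k\<in>UNIV. (if k \<in> S then v else w) $ (is $ k))"
    proof (rule sum.reindex_bij_witness[of _ "\<lambda>S. inv_into UNIV p ` S" "\<lambda>S. p ` S"])
      fix S :: "'k set"
      show "inv_into UNIV p ` p ` S = S" "p ` inv_into UNIV p ` S = S"
        using bp by (auto simp: image_comp bij_is_inj bij_is_surj surj_iff_all surj_f_inv_f image_iff)
      show "S \<in> {S. card S = i} \<Longrightarrow> p ` S \<in> {S. card S = i}"
        using bp by (auto simp: card_image bij_is_inj inj_on_subset[OF bij_is_inj])
      show "S \<in> {S. card S = i} \<Longrightarrow> inv_into UNIV p ` S \<in> {S. card S = i}"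
        using bij_imp_bij_inv[OF bp] by (auto simp: card_image bij_is_inj inj_on_subset[OF bij_is_inj])
      show "(\<Prod>k\<in>UNIV. (if k \<in> p ` S then v else w) $ (is $ k)) =
        (\<Prod>k\<in>UNIV. (if k \<in> S then v else w) $ (is $ p k))"
        by (subst prod.reindex_bij_betw[OF bp, symmetric])
          (auto intro!: prod.cong simp: inj_image_mem_iff[OF bij_is_inj[OF bp]])
    qed }
  then show ?thesis by (simp add: sym_tensors_def sym_monomial_def elementary_def)
qed

lemma sym_monomial_basis_nth:
  "(sym_monomial (axis 1 1) (axis 2 1) i :: ('k::finite) tensor) $ is =
     (if card {k. is $ k = 1} = i then 1 else 0)"
proof -
  have "(\<Prod>k\<in>UNIV. (if k \<in> S then axis 1 1 else axis 2 1 :: real^2) $ (is $ k)) =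
      (if S = {k. is $ k = 1} then 1 else 0)" for S
  proof (cases "S = {k. is $ k = 1}")
    case True
    then show ?thesis using exhaust_2 by (intro trans[OF prod.neutral]) (auto simp: axis_def)
  next
    case False
    then obtain k where "k \<in> S \<longleftrightarrow> is $ k \<noteq> 1" by auto
    then have "(if k \<in> S then axis 1 1 else axis 2 1 :: real^2) $ (is $ k) = 0"
      by (auto simp: axis_def)
    then have "(\<Prod>k\<in>UNIV. (if k \<in> S then axis 1 1 else axis 2 1 :: real^2) $ (is $ k)) = 0"
      by (intro prod_zero bexI[of _ k]) (assumption | simp)+
    with False show ?thesis by simp
  qed
  then show ?thesis by (simp add: sym_monomial_def elementary_def)
qed

lemma sym_monomial_neg:
  assumes "even CARD('k::finite)"
  shows "(sym_monomial (- v) (- w) i :: 'k tensor) = sym_monomial v w i"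
proof -
  have "(\<Prod>k\<in>UNIV. (if k \<in> S then - v else - w) $ (is $ k)) =
    (\<Prod>k\<in>UNIV. (if k \<in> S then v else w) $ (is $ k))" for S and "is" :: "2^'k"
  proof -
    have "(\<Prod>k\<in>UNIV. (if k \<in> S then - v else - w) $ (is $ k)) =
      (\<Prod>k\<in>UNIV. - 1 * ((if k \<in> S then v else w) $ (is $ k)))"
      by (rule prod.cong) auto
    then show ?thesis using assms by (simp add: prod.distrib prod_uminus)
  qed
  then show ?thesis by (simp add: sym_monomial_def elementary_def)
qed

lemma sym_rep_linear_extension:
  assumes ev: "even CARD('k::finite)" and \<gamma>: "\<gamma> \<in> carrier PSL2R" and A: "A \<in> \<gamma>"
  shows "sym_rep \<gamma> (\<Sum>i\<le>CARD('k). c i *\<^sub>R (sym_monomial (axis 1 1) (axis 2 1) i :: 'k tensor)) =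
     (\<Sum>i\<le>CARD('k). c i *\<^sub>R sym_monomial (A *v axis 1 1) (A *v axis 2 1) i)" (is "sym_rep \<gamma> ?T = ?U")
proof -
  have nth: "(\<Sum>i\<le>CARD('k). d i *\<^sub>R (sym_monomial (axis 1 1) (axis 2 1) i :: 'k tensor)) $ is
      = d (card {k. is $ k = 1})" for d and "is" :: "2^'k"
    using card_mono[of UNIV "{k. is $ k = 1}"]
    by (simp add: sym_monomial_basis_nth if_distrib cong: if_cong)
  have uniq: "d i = c i" if i: "i \<le> CARD('k)"
    and T: "?T = (\<Sum>i\<le>CARD('k). d i *\<^sub>R (sym_monomial (axis 1 1) (axis 2 1) i :: 'k tensor))" for d i
  proof -
    obtain S :: "'k set" where "card S = i"
      by (rule obtain_subset_with_card_n[OF i])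
    moreover define js :: "2^'k" where "js = (\<chi> k. if k \<in> S then 1 else 2)"
    ultimately have "card {k. js $ k = 1} = i" by simp
    then show ?thesis
      using nth[of c js] nth[of d js] by (simp only: T)
  qed
  have neg: "(- B) *v v = - (B *v v)" for B :: "real^2^2" and v
    by (simp add: matrix_vector_mult_def vec_eq_iff sum_negf)
  have lifts: "B = A \<or> B = - A" if "B \<in> \<gamma>" for B
    using \<gamma> A that by (auto simp: carrier_PSL2R)
  have "?T \<in> sym_tensors"
    using sym_monomial_sym[where 'k = 'k, of "axis 1 1" "axis 2 1"]
    unfolding sym_tensors_def by simp
  moreover have "(THE U. \<exists>B\<in>\<gamma>. \<exists>d. ?T = (\<Sum>i\<le>CARD('k). d i *\<^sub>R sym_monomial (axis 1 1) (axis 2 1) i) \<and>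
     U = (\<Sum>i\<le>CARD('k). d i *\<^sub>R sym_monomial (B *v axis 1 1) (B *v axis 2 1) i)) = ?U"
  proof (rule the_equality)
    show "\<exists>B\<in>\<gamma>. \<exists>d. ?T = (\<Sum>i\<le>CARD('k). d i *\<^sub>R sym_monomial (axis 1 1) (axis 2 1) i) \<and>
     ?U = (\<Sum>i\<le>CARD('k). d i *\<^sub>R sym_monomial (B *v axis 1 1) (B *v axis 2 1) i)"
      using A by blast
  next
    fix U :: "'k tensor" assume "\<exists>B\<in>\<gamma>. \<exists>d. ?T = (\<Sum>i\<le>CARD('k). d i *\<^sub>R sym_monomial (axis 1 1) (axis 2 1) i) \<and>
     U = (\<Sum>i\<le>CARD('k). d i *\<^sub>R sym_monomial (B *v axis 1 1) (B *v axis 2 1) i)"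
    then obtain B d where B: "B \<in> \<gamma>"
      and d: "?T = (\<Sum>i\<le>CARD('k). d i *\<^sub>R sym_monomial (axis 1 1) (axis 2 1) i)"
      and U: "U = (\<Sum>i\<le>CARD('k). d i *\<^sub>R sym_monomial (B *v axis 1 1) (B *v axis 2 1) i)" by blast
    have "U = (\<Sum>i\<le>CARD('k). c i *\<^sub>R sym_monomial (B *v axis 1 1) (B *v axis 2 1) i)"
      unfolding U using uniq[OF _ d] by (intro sum.cong) auto
    then show "U = ?U"
      using lifts[OF B] by (auto simp: neg sym_monomial_neg[OF ev])
  qed
  ultimately show ?thesis by (simp add: sym_rep_def)
qed

end

theory Submission
  imports Defs
begin

text \<open>Let \<open>v1, v2\<close> and \<open>w1, w2\<close> be positively oriented eigenbases of lifts of \<open>\<eta>\<close> and \<open>\<gamma>\<close>, and put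
  \<open>m = 2 n - 1\<close>, \<open>P = \<omega>(v1, w1) \<omega>(v2, w2)\<close> and \<open>Q = \<omega>(v1, w2) \<omega>(v2, w1)\<close>. Expanding the form on
  \<open>v1^m v2^m\<close> and \<open>w1^m w2^m\<close> over pairs of \<open>m\<close>-subsets of the \<open>2 m\<close> tensor factors, and sorting
  them by the size of their difference, gives
  \<open>- (2 m choose m) (\<Sum>j. (m choose j)^2 P^(m - j) Q^j)\<close>; the norms contribute
  \<open>(2 m choose m) (\<omega>(v1, v2) \<omega>(w1, w2))^m\<close>, which is \<open>(2 m choose m) (P - Q)^m\<close> by the Pluecker
  relation. The cross-ratio of the eigenlines is \<open>Q / P\<close>.\<close>

subsection \<open>Fixed points on the projective line\<close>

text \<open>Homogeneous coordinates absorb the case of infinity: the Moebius action becomes the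
  linear action on vectors, and equality of points becomes vanishing of \<open>area_form\<close>.
  The zero vector is also sent to \<open>None\<close>, hence the nonzero assumptions below.\<close>

definition proj_point :: "real^2 \<Rightarrow> real option" where
  "proj_point v = (if v$2 = 0 then None else Some (v$1 / v$2))"

lemma vec2_nonzero_iff: "v \<noteq> 0 \<longleftrightarrow> v$1 \<noteq> 0 \<or> v$2 \<noteq> (0::real)" for v :: "real^2"
  by (auto simp: vec_eq_iff forall_2)

lemma matrix_vector_mult_2:
  "((A :: real^2^2) *v v)$1 = A$1$1 * v$1 + A$1$2 * v$2"
  "(A *v v)$2 = A$2$1 * v$1 + A$2$2 * v$2"
  by (simp_all add: matrix_vector_mult_def sum_2)

section \<open>Alternating bilinear algebra in the plane\<close>

lemma area_form_self [simp]: "area_form v v = 0"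
  by (simp add: area_form_def)

lemma area_form_commute: "area_form w v = - area_form v w"
  by (simp add: area_form_def)

lemma area_form_scaleR [simp]:
  "area_form (a *\<^sub>R v) w = a * area_form v w" "area_form v (a *\<^sub>R w) = a * area_form v w"
  by (simp_all add: area_form_def algebra_simps)

lemma area_form_add:
  "area_form (v + v') w = area_form v w + area_form v' w"
  "area_form w (v + v') = area_form w v + area_form w v'"
  by (simp_all add: area_form_def algebra_simps)

lemma area_form_matrix: "area_form (A *v v) (A *v w) = det A * area_form v w"
  by (simp add: area_form_def det_2 matrix_vector_mult_2 algebra_simps)

lemma area_form_nonzeroD: "area_form v w \<noteq> 0 \<Longrightarrow> v \<noteq> 0 \<and> w \<noteq> 0"
  by (auto simp: area_form_def)

text \<open>Alternating such a product over three of the vectors gives a 3-form, which vanishes in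
  dimension two. The identity expresses the normalisation of the neutral vectors by the pairings
  that occur in the cross-ratio.\<close>

lemma area_form_Pluecker:
  "area_form a b * area_form c d =
    area_form a c * area_form b d - area_form a d * area_form b c"
  by (simp add: area_form_def algebra_simps)

lemma area_form_eq_0_parallel:
  assumes "area_form v w = 0" "v \<noteq> 0"
  obtains c where "w = c *\<^sub>R v"
proof (cases "v$1 = 0")
  case True
  with assms have "w = (w$2 / v$2) *\<^sub>R v"
    by (auto simp: area_form_def vec_eq_iff forall_2)
  then show ?thesis by (rule that)
next
  case False
  with assms have "w = (w$1 / v$1) *\<^sub>R v"
    by (auto simp: area_form_def vec_eq_iff forall_2 field_simps)
  then show ?thesis by (rule that)
qed

lemma area_form_basis:
  assumes "area_form v1 v2 \<noteq> 0"
  obtains a b where "v = a *\<^sub>R v1 + b *\<^sub>R v2"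
proof
  \<comment> \<open>Cramer's rule.\<close>
  show "v = (area_form v v2 / area_form v1 v2) *\<^sub>R v1 + (area_form v1 v / area_form v1 v2) *\<^sub>R v2"
    using assms by (simp add: vec_eq_iff forall_2 area_form_def divide_simps) (simp add: algebra_simps)
qed

lemma proj_point_surj: obtains v where "v \<noteq> 0" "p = proj_point v"
proof (cases p)
  case None
  then have "p = proj_point (axis 1 1)" by (simp add: proj_point_def axis_def)
  then show ?thesis by (intro that[of "axis 1 1"]) simp_all
next
  case (Some x)
  then have "p = proj_point (vector [x, 1])" by (simp add: proj_point_def)
  then show ?thesis by (intro that[of "vector [x, 1]"]) (simp_all add: vec2_nonzero_iff)
qed

lemma proj_point_eq_iff:
  assumes "v \<noteq> 0" "w \<noteq> 0"
  shows "proj_point v = proj_point w \<longleftrightarrow> area_form v w = 0"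
  using assms by (auto simp: proj_point_def area_form_def vec2_nonzero_iff field_simps)

lemma proj_point_scaleR [simp]: "c \<noteq> 0 \<Longrightarrow> proj_point (c *\<^sub>R v) = proj_point v"
  by (simp add: proj_point_def)

lemma proj_point_uminus [simp]: "proj_point (- v) = proj_point v"
  by (simp add: proj_point_def)

lemma moebius_proj_point: "v \<noteq> 0 \<Longrightarrow> moebius A (proj_point v) = proj_point (A *v v)"
proof (cases "v$2 = 0")
  case False
  then have "A$2$1 * (v$1 / v$2) + A$2$2 = (A *v v)$2 / v$2"
    "A$1$1 * (v$1 / v$2) + A$1$2 = (A *v v)$1 / v$2"
    by (simp_all add: matrix_vector_mult_2 add_divide_distrib)
  with False show ?thesis by (simp add: proj_point_def)
qed (auto simp: proj_point_def vec2_nonzero_iff matrix_vector_mult_2)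

section \<open>Convergence in the projective line and the dynamics of a loxodromic element\<close>

lemma limitin_proj_point:
  assumes u: "u \<longlonglongrightarrow> v" and v: "v \<noteq> 0"
  shows "limitin RP1 (\<lambda>k. proj_point (u k)) (proj_point v) sequentially"
proof (cases "v$2 = 0")
  case False
  have "(\<lambda>k. u k $ 1 / u k $ 2) \<longlonglongrightarrow> v$1 / v$2"
    using u False by (intro tendsto_intros)
  then have "limitin RP1 (\<lambda>k. Some (u k $ 1 / u k $ 2)) (Some (v$1 / v$2)) sequentially"
    using continuous_map_limit[OF continuous_map_Some, of euclideanreal] by (force simp: o_def)
  moreover have "\<forall>\<^sub>F k in sequentially. u k $ 2 \<noteq> 0"
    using tendsto_imp_eventually_ne[OF tendsto_vec_nth[OF u] False] .
  then have "\<forall>\<^sub>F k in sequentially. Some (u k $ 1 / u k $ 2) = proj_point (u k)"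
    by eventually_elim (simp add: proj_point_def)
  ultimately show ?thesis
    using limitin_transform_eventually False by (fastforce simp: proj_point_def)
next
  case True
  with v have v1: "v$1 \<noteq> 0" by (simp add: vec2_nonzero_iff)
  show ?thesis unfolding limitin_def
  proof safe
    fix U assume "openin RP1 U" "proj_point v \<in> U"
    then obtain C where C: "compact C" "U = insert None (Some ` (- C))"
      using True by (auto simp: proj_point_def openin_Alexandroff_compactification Compl_eq_Diff_UNIV)
    then obtain M where M: "\<And>x. x \<in> C \<Longrightarrow> \<bar>x\<bar> \<le> M"
      using compact_imp_bounded bounded_iff by (metis real_norm_def)
    \<comment> \<open>With the denominator cleared, escaping the bound \<open>M\<close> is a strict
      inequality that holds at \<open>v\<close> and therefore eventually along the sequence.\<close>
    have "(\<lambda>k. \<bar>u k $ 1\<bar> - M * \<bar>u k $ 2\<bar>) \<longlonglongrightarrow> \<bar>v$1\<bar> - M * \<bar>v$2\<bar>"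
      using u by (intro tendsto_intros)
    then have "\<forall>\<^sub>F k in sequentially. 0 < \<bar>u k $ 1\<bar> - M * \<bar>u k $ 2\<bar>"
      using True v1 by (intro order_tendstoD) auto
    then show "\<forall>\<^sub>F k in sequentially. proj_point (u k) \<in> U"
    proof eventually_elim
      case (elim k)
      show ?case
      proof (cases "u k $ 2 = 0")
        case False
        with elim have "\<not> \<bar>u k $ 1 / u k $ 2\<bar> \<le> M"
          by (simp add: field_simps)
        then have "u k $ 1 / u k $ 2 \<notin> C" using M by blast
        with C False show ?thesis by (auto simp: proj_point_def)
      qed (simp add: proj_point_def C)
    qed
  qed (cases "proj_point v"; simp)
qed

lemma RP1_limitin_unique:
  assumes "limitin RP1 f a sequentially" "limitin RP1 f b sequentially"
  shows "a = b"
proof -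
  have "Hausdorff_space RP1"
    by (simp add: Hausdorff_space_Alexandroff_compactification locally_compact_space_euclidean)
  then show ?thesis by (rule limitin_Hausdorff_unique[OF assms trivial_limit_sequentially])
qed

lemma matrix_vector_mult_uminus_left: "(- A) *v v = - (A *v v)" for A :: "real^2^2"
  by (simp add: vec_eq_iff forall_2 matrix_vector_mult_2)

lemma PSL2R_act_proj_point:
  assumes "v \<noteq> 0"
  shows "PSL2R_act {A, - A} (proj_point v) = proj_point (A *v v)"
  using assms unfolding PSL2R_act_def
  by (intro the_equality) (auto simp: moebius_proj_point matrix_vector_mult_uminus_left)

text \<open>The second conjunct strengthens the induction: the action is computed on nonzero
  representatives, and invertibility of \<open>A\<close> keeps them nonzero.\<close>

lemma PSL2R_act_pow_eigenvectors:
  assumes A: "det A = 1" "A *v v1 = l *\<^sub>R v1" "A *v v2 = inverse l *\<^sub>R v2" "l \<noteq> 0"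
    and nz: "a *\<^sub>R v1 + b *\<^sub>R v2 \<noteq> 0"
  shows "(PSL2R_act {A, - A} ^^ k) (proj_point (a *\<^sub>R v1 + b *\<^sub>R v2)) =
      proj_point ((a * l ^ k) *\<^sub>R v1 + (b * inverse l ^ k) *\<^sub>R v2) \<and>
    (a * l ^ k) *\<^sub>R v1 + (b * inverse l ^ k) *\<^sub>R v2 \<noteq> 0"
proof (induction k)
  case 0
  show ?case using nz by simp
next
  case (Suc k)
  let ?w = "(a * l ^ k) *\<^sub>R v1 + (b * inverse l ^ k) *\<^sub>R v2"
  have step: "A *v ?w = (a * l ^ Suc k) *\<^sub>R v1 + (b * inverse l ^ Suc k) *\<^sub>R v2"
    using A by (simp add: matrix_vector_right_distrib matrix_vector_mult_scaleR algebra_simps)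
  have "invertible A" using A by (simp add: invertible_det_nz)
  then have "A *v ?w \<noteq> 0"
    using Suc by (metis invertible_def matrix_vector_mul_assoc matrix_vector_mul_lid matrix_vector_mult_0_right)
  with Suc step show ?case by (simp add: PSL2R_act_proj_point)
qed

text \<open>Dividing the representative of the \<open>k\<close>-th iterate by
  \<open>a * l ^ k\<close> leaves \<open>v1\<close> plus a multiple of \<open>v2\<close> that decays
  like the \<open>k\<close>-th power of \<open>inverse l ^ 2\<close>.\<close>

lemma PSL2R_act_iterates_limitin:
  assumes A: "det A = 1" "A *v v1 = l *\<^sub>R v1" "A *v v2 = inverse l *\<^sub>R v2" "\<bar>l\<bar> > 1"
    and v: "area_form v1 v2 \<noteq> 0" and z: "z \<noteq> proj_point v2"
  shows "limitin RP1 (\<lambda>k. (PSL2R_act {A, - A} ^^ k) z) (proj_point v1) sequentially"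
proof -
  obtain u where u: "u \<noteq> 0" "z = proj_point u" by (rule proj_point_surj)
  obtain a b where ab: "u = a *\<^sub>R v1 + b *\<^sub>R v2" by (rule area_form_basis[OF v])
  have l: "l \<noteq> 0" using A by auto
  \<comment> \<open>With \<open>a = 0\<close> the nonzero vector \<open>u\<close> would span the
    line of \<open>v2\<close>.\<close>
  have a: "a \<noteq> 0" using z u ab by auto
  have "(PSL2R_act {A, - A} ^^ k) z = proj_point (v1 + (b / a * (inverse l ^ 2) ^ k) *\<^sub>R v2)" for k
  proof -
    have "(PSL2R_act {A, - A} ^^ k) z =
        proj_point ((a * l ^ k) *\<^sub>R v1 + (b * inverse l ^ k) *\<^sub>R v2)"
      using PSL2R_act_pow_eigenvectors[OF A(1-3) l, of a b k] u ab by simp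
    also have "(a * l ^ k) *\<^sub>R v1 + (b * inverse l ^ k) *\<^sub>R v2 =
        (a * l ^ k) *\<^sub>R (v1 + (b / a * (inverse l ^ 2) ^ k) *\<^sub>R v2)"
      using a l by (simp add: scaleR_right_distrib field_simps power2_eq_square flip: power_mult_distrib)
    finally show ?thesis using a l by simp
  qed
  moreover have "(\<lambda>k. v1 + (b / a * (inverse l ^ 2) ^ k) *\<^sub>R v2) \<longlonglongrightarrow> v1 + (b / a * 0) *\<^sub>R v2"
  proof (intro tendsto_intros LIMSEQ_power_zero)
    have "\<bar>inverse l\<bar> < 1" using A(4) by (simp add: field_simps)
    then show "norm ((inverse l)\<^sup>2) < 1"
      by (simp add: abs_square_less_1)
  qed
  ultimately show ?thesis
    using limitin_proj_point[of _ v1] area_form_nonzeroD[OF v] by simp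
qed

text \<open>The complement of \<open>proj_point v2\<close> is a basin of
  \<open>proj_point v1\<close>. Conversely, the neighbourhood of any attracting fixed point contains
  a point other than \<open>proj_point v2\<close>; its orbit converges to both candidates, which
  agree by uniqueness of limits.\<close>

lemma attracting_eq:
  assumes A: "det A = 1" "A *v v1 = l *\<^sub>R v1" "A *v v2 = inverse l *\<^sub>R v2" "\<bar>l\<bar> > 1"
    and v: "area_form v1 v2 \<noteq> 0"
  shows "attracting {A, - A} = proj_point v1"
  unfolding attracting_def
proof (rule the_equality)
  note lim = PSL2R_act_iterates_limitin[OF A v]
  have nz: "v1 \<noteq> 0" "v2 \<noteq> 0" using area_form_nonzeroD[OF v] by auto
  have ne: "proj_point v1 \<noteq> proj_point v2" using v nz by (simp add: proj_point_eq_iff)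
  have t1: "t1_space RP1"
    by (simp add: t1_space_euclidean)
  then have "closedin RP1 {proj_point v2}"
    by (simp add: t1_space_closedin_singleton) (cases "proj_point v2"; simp)
  then have "openin RP1 (- {proj_point v2})"
    by (simp add: closedin_def Compl_eq_Diff_UNIV notin_range_Some UNIV_option_conv)
  moreover have "PSL2R_act {A, - A} (proj_point v1) = proj_point v1"
    using nz A by (auto simp: PSL2R_act_proj_point)
  ultimately show "attracting_fixed_point {A, - A} (proj_point v1)"
    using lim ne unfolding attracting_fixed_point_def by (intro conjI exI[of _ "- {proj_point v2}"]) auto
  fix p assume "attracting_fixed_point {A, - A} p"
  then obtain U where U: "openin RP1 U" "p \<in> U"
    "\<And>z. z \<in> U \<Longrightarrow> limitin RP1 (\<lambda>k. (PSL2R_act {A, - A} ^^ k) z) p sequentially"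
    by (auto simp: attracting_fixed_point_def)
  have "\<exists>z\<in>U. z \<noteq> proj_point v2"
  proof (cases "p = proj_point v2")
    case True
    \<comment> \<open>The point \<open>proj_point v2\<close> is not isolated: the lines of these
      vectors differ from it and approach it.\<close>
    have "(\<lambda>k. v2 + inverse (real (Suc k)) *\<^sub>R v1) \<longlonglongrightarrow> v2 + 0 *\<^sub>R v1"
      by (intro tendsto_intros LIMSEQ_inverse_real_of_nat)
    then have "limitin RP1 (\<lambda>k. proj_point (v2 + inverse (real (Suc k)) *\<^sub>R v1))
        (proj_point v2) sequentially"
      using nz by (intro limitin_proj_point) auto
    then have "\<forall>\<^sub>F k in sequentially. proj_point (v2 + inverse (real (Suc k)) *\<^sub>R v1) \<in> U"
      using U True by (auto dest: limitinD)
    then obtain k where k: "proj_point (v2 + inverse (real (Suc k)) *\<^sub>R v1) \<in> U"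
      by (auto dest: eventually_happens)
    have "area_form (v2 + inverse (real (Suc k)) *\<^sub>R v1) v2 \<noteq> 0"
      using v by (simp add: area_form_add)
    then have "proj_point (v2 + inverse (real (Suc k)) *\<^sub>R v1) \<noteq> proj_point v2"
      using proj_point_eq_iff area_form_nonzeroD by blast
    with k show ?thesis by blast
  qed (use U in blast)
  then show "p = proj_point v1" using lim U RP1_limitin_unique by blast
qed

lemma PSL2R_inv:
  fixes A B :: "real^2^2"
  assumes "det A = 1" "B ** A = mat 1"
  shows "inv\<^bsub>PSL2R\<^esub> {A, - A} = {B, - B}"
proof -
  interpret group PSL2R by (rule PSL2R_group)
  have "det B = 1" using det_mul[of B A] assms by simp
  moreover have "{B, - B} \<otimes>\<^bsub>PSL2R\<^esub> {A, - A} = \<one>\<^bsub>PSL2R\<^esub>"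
    using assms by (auto simp: PSL2R_def set_mult_def SL2R_def)
  ultimately show ?thesis using assms by (intro inv_equality) (auto simp: carrier_PSL2R)
qed

text \<open>The inverse matrix has the same eigenlines with the eigenvalues exchanged, so its
  attracting point is the line of \<open>v2\<close>.\<close>

lemma repelling_eq:
  assumes A: "det A = 1" "A *v v1 = l *\<^sub>R v1" "A *v v2 = inverse l *\<^sub>R v2" "\<bar>l\<bar> > 1"
    and v: "area_form v1 v2 \<noteq> 0"
  shows "repelling {A, - A} = proj_point v2"
proof -
  obtain B where B: "B ** A = mat 1"
    using invertible_det_nz[of A] A unfolding invertible_def by auto
  have l: "l \<noteq> 0" using A by auto
  have BA: "B *v (A *v x) = x" for x using B by (simp add: matrix_vector_mul_assoc)
  have "repelling {A, - A} = attracting {B, - B}"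
    by (simp add: repelling_def attracting_def PSL2R_inv[OF A(1) B])
  also have "\<dots> = proj_point v2"
  proof (rule attracting_eq)
    show "det B = 1" using det_mul[of B A] A B by simp
    show "B *v v2 = l *\<^sub>R v2"
      using BA[of "l *\<^sub>R v2"] A l by (simp add: matrix_vector_mult_scaleR)
    show "B *v v1 = inverse l *\<^sub>R v1"
      using BA[of "inverse l *\<^sub>R v1"] A l by (simp add: matrix_vector_mult_scaleR)
    show "area_form v2 v1 \<noteq> 0" using v by (simp add: area_form_commute[of v2])
  qed fact
  finally show ?thesis .
qed

section \<open>The cross-ratio in homogeneous coordinates and oriented eigenbases\<close>

lemma cross_ratio_proj_point:
  assumes "distinct [proj_point a, proj_point b, proj_point c, proj_point d]"
    and "a \<noteq> 0" "b \<noteq> 0" "c \<noteq> 0" "d \<noteq> 0"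
  shows "cross_ratio (proj_point a) (proj_point b) (proj_point c) (proj_point d) =
    (area_form c a * area_form d b) / (area_form c b * area_form d a)"
proof -
  \<comment> \<open>Finite points differ by \<open>area_form\<close> over the product of the second
    coordinates, and these denominators cancel in the cross-ratio. Distinctness allows at most one
    point at infinity, so the \<open>undefined\<close> equation is never reached.\<close>
  have *: "p / q - r / s = (p * s - q * r) / (q * s)" if "q \<noteq> 0" "s \<noteq> 0" for p q r s :: real
    using that by (simp add: field_simps)
  show ?thesis
    using assms by (auto simp: proj_point_def area_form_def vec2_nonzero_iff * mult.commute split: if_splits)
qed

text \<open>Eigenvectors for different eigenvalues are independent, so preservation of
  \<open>area_form\<close> forces \<open>l * m = 1\<close>. As \<open>l\<close> and \<open>m\<close>
  differ, exactly one of them has absolute value above 1, and its eigenvector is put first.\<close>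

lemma loxodromic_eigenvectors:
  assumes "\<gamma> \<in> carrier PSL2R" "loxodromic \<gamma>"
  obtains A l v1 v2 where "\<gamma> = {A, - A}" "det A = 1" "\<bar>l\<bar> > 1"
    "A *v v1 = l *\<^sub>R v1" "A *v v2 = inverse l *\<^sub>R v2" "area_form v1 v2 > 0"
proof -
  note goal = that
  have main: thesis
    if "A \<in> \<gamma>" "\<bar>l\<bar> > 1" "A *v v = l *\<^sub>R v" "A *v w = m *\<^sub>R w" "l * m = 1" "area_form v w \<noteq> 0"
    for A l m v w
  proof -
    have A: "\<gamma> = {A, - A}" "det A = 1"
      using assms(1) that(1) by (auto simp: carrier_PSL2R)
    have m: "m = inverse l" using that by (metis inverse_unique)
    \<comment> \<open>The sign makes the basis positively oriented and keeps the eigenvalue.\<close>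
    define w' where "w' = sgn (area_form v w) *\<^sub>R w"
    have "A *v w' = inverse l *\<^sub>R w'"
      using that m by (simp add: w'_def matrix_vector_mult_scaleR)
    moreover have "area_form v w' > 0"
      using that by (simp add: w'_def sgn_if)
    ultimately show thesis using that A by (intro goal) auto
  qed
  from assms(2) obtain A l m v w where A: "A \<in> \<gamma>" and lm: "l \<noteq> m"
    and v: "v \<noteq> 0" "A *v v = l *\<^sub>R v" and w: "w \<noteq> 0" "A *v w = m *\<^sub>R w"
    by (auto simp: loxodromic_def)
  have det: "det A = 1" using A assms(1) by (auto simp: carrier_PSL2R)
  have vw: "area_form v w \<noteq> 0"
  proof
    assume "area_form v w = 0"
    then obtain c where c: "w = c *\<^sub>R v" using area_form_eq_0_parallel v by blast
    then have "(c * l) *\<^sub>R v = (c * m) *\<^sub>R v"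
      using v w by (simp add: matrix_vector_mult_scaleR mult.commute)
    with c v w lm show False by auto
  qed
  have prod: "l * m = 1"
    using area_form_matrix[of A v w] det v w vw by (simp add: mult.commute)
  show thesis
  proof (cases "\<bar>l\<bar> > 1")
    case True
    then show thesis using main A v w prod vw by blast
  next
    case False
    have "\<bar>l\<bar> * \<bar>m\<bar> = 1" using prod by (simp flip: abs_mult)
    moreover have "\<bar>l\<bar> \<noteq> 1"
      using prod lm by (auto simp: abs_if split: if_splits)
    ultimately have "\<bar>m\<bar> > 1"
      using False by (smt (verit) mult_left_le mult_le_one mult_less_cancel_right2 abs_ge_zero)
    moreover have "area_form w v \<noteq> 0" using vw by (simp add: area_form_commute[of w])
    moreover have "m * l = 1" using prod by (simp add: mult.commute)
    ultimately show thesis using main A v w by blast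
  qed
qed

subsection \<open>The invariant form on symmetric monomials\<close>

lemma card_Compl: "card (- S) = CARD('a) - card S" for S :: "'a::finite set"
  by (simp add: Compl_eq_Diff_UNIV card_Diff_subset)

text \<open>\<open>T\<close> is determined by its parts in \<open>S\<close> and in
  \<open>- S\<close>, of sizes \<open>j\<close> and \<open>m - j\<close>; symmetry of the binomial
  coefficient makes the two counts equal.\<close>

lemma card_subsets_Int:
  fixes S :: "'a::finite set"
  assumes "card S = m" "card (- S) = m" "j \<le> m"
  shows "card {T. card T = m \<and> card (T \<inter> S) = j} = (m choose j) ^ 2"
proof -
  have "bij_betw (\<lambda>(X, Y). X \<union> Y)
      ({X. X \<subseteq> S \<and> card X = j} \<times> {Y. Y \<subseteq> - S \<and> card Y = m - j})
      {T. card T = m \<and> card (T \<inter> S) = j}"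
  proof (rule bij_betwI[where g = "\<lambda>T. (T \<inter> S, T \<inter> - S)"])
    show "(\<lambda>(X, Y). X \<union> Y) \<in> ({X. X \<subseteq> S \<and> card X = j} \<times> {Y. Y \<subseteq> - S \<and> card Y = m - j}) \<rightarrow>
      {T. card T = m \<and> card (T \<inter> S) = j}"
    proof (clarsimp)
      fix X Y assume X: "X \<subseteq> S" "j = card X" and Y: "Y \<subseteq> - S" "card Y = m - card X"
      then have "(X \<union> Y) \<inter> S = X" "X \<inter> Y = {}" by auto
      with X Y assms(3) show "card (X \<union> Y) = m \<and> card ((X \<union> Y) \<inter> S) = card X"
        by (simp add: card_Un_disjoint)
    qed
    show "(\<lambda>T. (T \<inter> S, T \<inter> - S)) \<in> {T. card T = m \<and> card (T \<inter> S) = j} \<rightarrow>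
      {X. X \<subseteq> S \<and> card X = j} \<times> {Y. Y \<subseteq> - S \<and> card Y = m - j}"
      by (auto simp: card_Diff_subset_Int simp flip: Diff_eq)
  qed auto
  then have "card {T. card T = m \<and> card (T \<inter> S) = j} = (m choose j) * (m choose (m - j))"
    using assms by (simp add: n_subsets card_cartesian_product flip: bij_betw_same_card)
  then show ?thesis
    using binomial_symmetric[OF assms(3)] by (simp add: power2_eq_square)
qed

lemma sum_subsets_Int:
  fixes S :: "'a::finite set" and g :: "nat \<Rightarrow> real"
  assumes "card S = m" "card (- S) = m"
  shows "(\<Sum>T | card T = m. g (card (T \<inter> S))) = (\<Sum>j = 0..m. real (m choose j) ^ 2 * g j)"
proof -
  have "card (T \<inter> S) \<le> m" for T
    using card_mono[of S "T \<inter> S"] assms by simp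
  then have "(\<Sum>T | card T = m. g (card (T \<inter> S))) =
      (\<Sum>j = 0..m. \<Sum>T | T \<in> {T. card T = m} \<and> card (T \<inter> S) = j. g (card (T \<inter> S)))"
    by (intro sum.group[symmetric]) auto
  also have "\<dots> = (\<Sum>j = 0..m. real (m choose j) ^ 2 * g j)"
    using assms by (intro sum.cong) (simp_all add: card_subsets_Int)
  finally show ?thesis .
qed

text \<open>The factors fall into four cells by membership in \<open>S\<close> and \<open>T\<close>.
  Since both sets and their complements have \<open>m\<close> elements, the size of
  \<open>T \<inter> - S\<close> fixes the other three.\<close>

lemma prod_area_form_subsets:
  fixes S T :: "'k::finite set"
  assumes "CARD('k) = 2 * m" "card S = m" "card T = m"
  shows "(\<Prod>k\<in>UNIV. area_form (if k \<in> S then a else b) (if k \<in> T then c else d)) =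
    (area_form a c * area_form b d) ^ (m - card (T \<inter> - S)) *
    (area_form a d * area_form b c) ^ card (T \<inter> - S)"
proof -
  define j where "j = card (T \<inter> - S)"
  have T: "card (T \<inter> S) + j = m"
    using card_Un_disjoint[of "T \<inter> S" "T \<inter> - S"] assms(3)
    by (simp add: j_def flip: Int_Un_distrib)
  have S: "card (S \<inter> T) + card (S \<inter> - T) = m"
    using card_Un_disjoint[of "S \<inter> T" "S \<inter> - T"] assms(2)
    by (simp flip: Int_Un_distrib)
  have C: "card (- S \<inter> T) + card (- S \<inter> - T) = m"
    using card_Un_disjoint[of "- S \<inter> T" "- S \<inter> - T"] assms(1,2)
    by (simp add: card_Compl flip: Int_Un_distrib)
  have cards: "card (S \<inter> T) = m - j" "card (S \<inter> - T) = j" "card (- S \<inter> T) = j"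
    "card (- S \<inter> - T) = m - j"
    using S T C by (auto simp: j_def Int_commute)
  have const: "(\<Prod>k\<in>UNIV. if k \<in> X then x else 1) = x ^ card X" for X :: "'k set" and x :: real
    by (simp add: prod.If_cases)
  have "(\<Prod>k\<in>UNIV. area_form (if k \<in> S then a else b) (if k \<in> T then c else d)) =
    (\<Prod>k\<in>UNIV. (if k \<in> S \<inter> T then area_form a c else 1) *
      (if k \<in> S \<inter> - T then area_form a d else 1) *
      ((if k \<in> - S \<inter> T then area_form b c else 1) *
      (if k \<in> - S \<inter> - T then area_form b d else 1)))"
    by (intro prod.cong) auto
  also have "\<dots> = area_form a c ^ (m - j) * area_form a d ^ j *
      (area_form b c ^ j * area_form b d ^ (m - j))"
    unfolding prod.distrib const cards ..
  finally show ?thesis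
    by (simp add: j_def power_mult_distrib mult_ac)
qed

text \<open>The inner sum over \<open>T\<close> has the same value for each of the
  \<open>2 * m choose m\<close> sets \<open>S\<close>, because only the size of
  \<open>T \<inter> - S\<close> enters.\<close>

lemma tensor_form_sym_monomial:
  assumes N: "CARD('k::finite) = 2 * m"
  shows "tensor_form (sym_monomial a b m :: 'k tensor) (sym_monomial c d m) =
    - (real (2 * m choose m) * (\<Sum>j = 0..m. real (m choose j) ^ 2 *
      ((area_form a c * area_form b d) ^ (m - j) * (area_form a d * area_form b c) ^ j)))"
    (is "_ = - (_ * ?R)")
proof -
  let ?M = "{S :: 'k set. card S = m}"
  have "tensor_form (sym_monomial a b m :: 'k tensor) (sym_monomial c d m) =
    (\<Sum>S\<in>?M. \<Sum>T\<in>?M. tensor_form (elementary (\<lambda>k. if k \<in> S then a else b) :: 'k tensor)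
      (elementary (\<lambda>k. if k \<in> T then c else d)))"
    unfolding sym_monomial_def
    by (simp add: bilinear_sum[OF tensor_form_bilinear] sum.cartesian_product)
  also have "\<dots> = (\<Sum>S\<in>?M. - ?R)"
  proof (rule sum.cong[OF refl])
    fix S :: "'k set" assume "S \<in> ?M"
    then have S: "card S = m" "card (- S) = m" "card (- (- S)) = m"
      using N by (simp_all add: card_Compl)
    have "(\<Sum>T\<in>?M. tensor_form (elementary (\<lambda>k. if k \<in> S then a else b) :: 'k tensor)
        (elementary (\<lambda>k. if k \<in> T then c else d))) =
      - (\<Sum>T\<in>?M. (area_form a c * area_form b d) ^ (m - card (T \<inter> - S)) *
        (area_form a d * area_form b c) ^ card (T \<inter> - S))"
      using prod_area_form_subsets[OF N S(1)] by (simp add: tensor_form_elementary sum_negf)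
    also have "\<dots> = - ?R"
      \<comment> \<open>The exponents count elements outside \<open>S\<close>, so the counting lemma
        is applied to \<open>- S\<close>.\<close>
      by (subst sum_subsets_Int[OF S(2,3)]) (rule refl)
    finally show "(\<Sum>T\<in>?M. tensor_form (elementary (\<lambda>k. if k \<in> S then a else b) :: 'k tensor)
        (elementary (\<lambda>k. if k \<in> T then c else d))) = - ?R" .
  qed
  also have "\<dots> = - (real (2 * m choose m) * ?R)"
    using n_subsets[of "UNIV :: 'k set" m] N by simp
  finally show ?thesis .
qed

text \<open>Each vector pairs to zero with itself, so only \<open>j = m\<close> survives, where the
  zero base has exponent 0. Oddness of \<open>m\<close> makes the sign of that term cancel the sign
  in the form, so the square root in the neutral vector is taken of a nonnegative number.\<close>

lemma tensor_form_sym_monomial_self: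
  assumes N: "CARD('k::finite) = 2 * m" and m: "odd m"
  shows "tensor_form (sym_monomial a b m :: 'k tensor) (sym_monomial a b m) =
    real (2 * m choose m) * (area_form a b ^ m) ^ 2"
proof -
  have "(\<Sum>j = 0..m. real (m choose j) ^ 2 * (0 ^ (m - j) * (area_form a b * area_form b a) ^ j)) =
    (area_form a b * area_form b a) ^ m"
    by (subst sum.remove[of _ m]) (auto intro!: sum.neutral)
  also have "\<dots> = - ((area_form a b ^ m) ^ 2)"
    using m by (simp add: area_form_commute[of b] power_mult_distrib power2_eq_square flip: power_mult_distrib)
  finally show ?thesis
    by (simp add: tensor_form_sym_monomial[OF N])
qed

lemma sym_monomial_scaleR:
  "(sym_monomial (a *\<^sub>R v) (b *\<^sub>R w) i :: ('k::finite) tensor) =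
    (a ^ i * b ^ (CARD('k) - i)) *\<^sub>R sym_monomial v w i"
proof -
  have "(elementary (\<lambda>k. if k \<in> S then a *\<^sub>R v else b *\<^sub>R w) :: 'k tensor) =
      (a ^ i * b ^ (CARD('k) - i)) *\<^sub>R elementary (\<lambda>k. if k \<in> S then v else w)"
    if "card S = i" for S :: "'k set"
  proof -
    have "(\<Prod>k\<in>UNIV. (if k \<in> S then a *\<^sub>R v else b *\<^sub>R w) $ (is $ k)) =
      (\<Prod>k\<in>UNIV. if k \<in> S then a else b) * (\<Prod>k\<in>UNIV. (if k \<in> S then v else w) $ (is $ k))"
      for "is" :: "2^'k"
      unfolding prod.distrib[symmetric] by (intro prod.cong) auto
    moreover have "(\<Prod>k\<in>UNIV. if k \<in> S then a else b) = a ^ i * b ^ (CARD('k) - i)"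
      using that by (simp add: prod.If_cases card_Compl)
    ultimately show ?thesis by (simp add: elementary_def vec_eq_iff)
  qed
  then show ?thesis by (simp add: sym_monomial_def scaleR_sum_right)
qed

text \<open>The two extreme monomials, here and in the next lemma, are pure powers; faithfulness is
  read off from them.\<close>

lemma sym_monomial_full: "(sym_monomial v w CARD('k) :: ('k::finite) tensor) = elementary (\<lambda>_. v)"
proof -
  have "{S :: 'k set. card S = CARD('k)} = {UNIV}"
    using card_subset_eq[of "UNIV :: 'k set"] by auto
  then show ?thesis by (simp add: sym_monomial_def)
qed

lemma sym_monomial_0: "(sym_monomial v w 0 :: ('k::finite) tensor) = elementary (\<lambda>_. w)"
proof -
  have "{S :: 'k set. card S = 0} = {{}}" by auto
  then show ?thesis by (simp add: sym_monomial_def)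
qed

subsection \<open>Faithfulness of the representation and neutral vectors\<close>

lemma sym_rep_sym_monomial:
  assumes "even CARD('k::finite)" "\<gamma> \<in> carrier PSL2R" "A \<in> \<gamma>" "i \<le> CARD('k)"
  shows "sym_rep \<gamma> (sym_monomial (axis 1 1) (axis 2 1) i :: 'k tensor) =
    sym_monomial (A *v axis 1 1) (A *v axis 2 1) i"
proof -
  have "(\<Sum>j\<le>CARD('k). (if j = i then 1 else 0) *\<^sub>R f j) = f i" for f :: "nat \<Rightarrow> 'k tensor"
    using assms(4) by (subst sum.remove[of _ i]) auto
  then show ?thesis
    using sym_rep_linear_extension[OF assms(1-3), of "\<lambda>j. if j = i then 1 else 0"] by simp
qed

text \<open>Coordinates with a constant index determine the entries up to sign only, the exponent
  being even; a mixed coordinate then forces a common sign.\<close>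

lemma elementary_const_eqD:
  fixes v w :: "real^2"
  assumes "(elementary (\<lambda>_. v) :: ('k::finite) tensor) = elementary (\<lambda>_. w)" "even CARD('k)"
  obtains s where "s = 1 \<or> s = -1" "w = s *\<^sub>R v"
proof -
  have pow: "(\<Prod>k\<in>UNIV. v $ (is $ k)) = (\<Prod>k\<in>UNIV. w $ (is $ k))" for "is" :: "2^'k"
    using assms(1) by (simp add: elementary_def vec_eq_iff)
  have N: "CARD('k) > 0" by simp
  have abs: "\<bar>v $ i\<bar> = \<bar>w $ i\<bar>" for i
  proof -
    have "v $ i ^ CARD('k) = w $ i ^ CARD('k)"
      using pow[of "\<chi> k. i"] by simp
    then have "\<bar>v $ i\<bar> ^ CARD('k) = \<bar>w $ i\<bar> ^ CARD('k)"
      using assms(2) by (simp add: power_even_abs)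
    then show ?thesis using N power_eq_imp_eq_base[of "\<bar>v $ i\<bar>" "CARD('k)"] by simp
  qed
  show thesis
  proof (cases "v $ 1 = 0")
    case True
    then have "w $ 1 = 0" using abs[of 1] by simp
    moreover have "w $ 2 = v $ 2 \<or> w $ 2 = - v $ 2" using abs[of 2] by (auto simp: abs_if split: if_splits)
    ultimately show thesis
      using True that[of 1] that[of "-1"] by (auto simp: vec_eq_iff forall_2)
  next
    case False
    obtain s :: real where s: "s = 1 \<or> s = -1" "w $ 1 = s * v $ 1"
      using abs[of 1] that[of 1] that[of "-1"] by (auto simp: abs_if split: if_splits)
    fix k0 :: 'k
    \<comment> \<open>The coordinates with one index \<open>2\<close> rule out independent sign changes of the two entries.\<close>
    have mixed: "(\<Prod>k\<in>UNIV. x $ ((\<chi> k. if k = k0 then 2 else 1) $ k)) = x $ 2 * x $ 1 ^ (CARD('k) - 1)"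
      for x :: "real^2"
      by (subst prod.remove[of _ k0]) (simp_all add: card_Diff_singleton)
    have "odd (CARD('k) - 1)" using assms(2) N by simp
    then have "s ^ (CARD('k) - 1) = s" using s(1) by auto
    then have "v $ 2 * v $ 1 ^ (CARD('k) - 1) = w $ 2 * (s * v $ 1 ^ (CARD('k) - 1))"
      using pow[of "\<chi> k. if k = k0 then 2 else 1"] s(2) by (simp only: mixed power_mult_distrib)
    then have "v $ 2 = s * w $ 2" using False by simp
    with s show thesis by (intro that[of s]) (auto simp: vec_eq_iff forall_2)
  qed
qed

text \<open>\<open>neutral_vector\<close> sees only the map, so the group element has to be
  recovered from it. The extreme monomials give each column of a lift up to sign, and the
  determinant rules out opposite signs.\<close>

lemma sym_rep_inj:
  assumes ev: "even CARD('k::finite)" and g: "\<gamma> \<in> carrier PSL2R" "\<gamma>' \<in> carrier PSL2R"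
    and eq: "(sym_rep \<gamma> :: 'k tensor \<Rightarrow> 'k tensor) = sym_rep \<gamma>'"
  shows "\<gamma> = \<gamma>'"
proof -
  obtain A A' where A: "det A = 1" "\<gamma> = {A, - A}" and A': "det A' = 1" "\<gamma>' = {A', - A'}"
    using g by (auto simp: carrier_PSL2R)
  have mono: "(sym_monomial (A *v axis 1 1) (A *v axis 2 1) i :: 'k tensor) =
      sym_monomial (A' *v axis 1 1) (A' *v axis 2 1) i" if "i \<le> CARD('k)" for i
    using sym_rep_sym_monomial[OF ev g(1) _ that, of A] sym_rep_sym_monomial[OF ev g(2) _ that, of A']
      A A' eq by simp
  obtain r where r: "r = 1 \<or> r = -1" "A' *v axis 1 1 = r *\<^sub>R (A *v axis 1 1)"
    using elementary_const_eqD[OF _ ev] mono[of "CARD('k)"] by (auto simp: sym_monomial_full)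
  obtain s where s: "s = 1 \<or> s = -1" "A' *v axis 2 1 = s *\<^sub>R (A *v axis 2 1)"
    using elementary_const_eqD[OF _ ev] mono[of 0] by (auto simp: sym_monomial_0)
  have "r * s = 1"
    using area_form_matrix[of A "axis 1 1" "axis 2 1"] area_form_matrix[of A' "axis 1 1" "axis 2 1"] A A' r s
    by (auto simp: area_form_def axis_def)
  then have "r = s" using r s by auto
  then have "A' = r *\<^sub>R A"
    using r s by (simp add: vec_eq_iff forall_2 matrix_vector_mult_2 axis_def)
  with r A A' show ?thesis by auto
qed

text \<open>A map of determinant 1 preserves \<open>area_form\<close>, yet multiplies its value on
  the two eigenvectors by \<open>l * l'\<close>; hence that value is 0.\<close>

lemma eigenvectors_parallel:
  fixes A :: "real^2^2"
  assumes "det A = 1" "A *v v = l *\<^sub>R v" "A *v v' = l' *\<^sub>R v'" "l * l' \<noteq> 1" "v \<noteq> 0"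
  obtains c where "v' = c *\<^sub>R v"
proof -
  have "l * l' * area_form v v' = area_form v v'"
    using area_form_matrix[of A v v'] assms by (simp add: mult.commute)
  then have "area_form v v' = 0" using assms by simp
  then show thesis using area_form_eq_0_parallel that assms by blast
qed

text \<open>The point is independence of all choices. Faithfulness recovers the class, its two lifts
  share their eigenlines, and rescaling the eigenvectors by \<open>a\<close> and \<open>b\<close>
  with \<open>a * b > 0\<close> multiplies monomial and norm by the same
  \<open>(a * b) ^ m\<close>.\<close>

lemma neutral_vector_eq:
  assumes n: "n \<ge> 1" and N: "CARD('k::finite) = 4 * n - 2"
    and A: "det A = 1" "A *v v1 = l *\<^sub>R v1" "A *v v2 = inverse l *\<^sub>R v2" "\<bar>l\<bar> > 1"
    and v: "area_form v1 v2 > 0"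
  shows "neutral_vector n (sym_rep {A, - A} :: 'k tensor \<Rightarrow> 'k tensor) =
    inverse (sqrt (real (2 * (2 * n - 1) choose (2 * n - 1))) * area_form v1 v2 ^ (2 * n - 1)) *\<^sub>R
      sym_monomial v1 v2 (2 * n - 1)"
proof -
  define m where "m = 2 * n - 1"
  have m: "odd m" "CARD('k) = 2 * m" using n N by (auto simp: m_def)
  have ev: "even CARD('k)" using m by simp
  have carrier: "{A, - A} \<in> carrier PSL2R" using A by (auto simp: carrier_PSL2R)
  have nz: "v1 \<noteq> 0" "v2 \<noteq> 0" using area_form_nonzeroD[of v1 v2] v by auto
  have l1: "\<bar>l\<bar> > \<bar>inverse l\<bar>" using A(4) by (simp add: field_simps) (metis abs_mult_self_eq less_1_mult)
  have lox: "loxodromic {A, - A}"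
    unfolding loxodromic_def using A nz l1 by (intro bexI[of _ A] exI[of _ l] exI[of _ "inverse l"]) auto
  have norm: "u /\<^sub>R sqrt (tensor_form u u) =
      inverse (sqrt (real (2 * m choose m)) * area_form a b ^ m) *\<^sub>R sym_monomial a b m"
    if "area_form a b > 0" "u = sym_monomial a b m" for a b and u :: "'k tensor"
    using that by (simp add: tensor_form_sym_monomial_self[OF m(2,1)] real_sqrt_mult)
  show ?thesis unfolding neutral_vector_def m_def[symmetric]
  proof (rule the_equality)
    show "\<exists>\<gamma>\<in>carrier PSL2R. loxodromic \<gamma> \<and> (sym_rep {A, - A} :: 'k tensor \<Rightarrow> 'k tensor) = sym_rep \<gamma> \<and>
      (\<exists>A\<in>\<gamma>. \<exists>l w1 w2. \<bar>l\<bar> > \<bar>inverse l\<bar> \<and> A *v w1 = l *\<^sub>R w1 \<and> A *v w2 = inverse l *\<^sub>R w2 \<and>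
        area_form w1 w2 > 0 \<and> (let u = sym_monomial w1 w2 m in
        inverse (sqrt (real (2 * m choose m)) * area_form v1 v2 ^ m) *\<^sub>R (sym_monomial v1 v2 m :: 'k tensor)
          = u /\<^sub>R sqrt (tensor_form u u)))"
      using carrier lox A l1 v norm[OF v refl]
      by (intro bexI[of _ "{A, - A}"] conjI bexI[of _ A] exI[of _ l] exI[of _ v1] exI[of _ v2]) auto
  next
    fix x :: "'k tensor"
    assume "\<exists>\<gamma>\<in>carrier PSL2R. loxodromic \<gamma> \<and> (sym_rep {A, - A} :: 'k tensor \<Rightarrow> 'k tensor) = sym_rep \<gamma> \<and>
      (\<exists>A\<in>\<gamma>. \<exists>l w1 w2. \<bar>l\<bar> > \<bar>inverse l\<bar> \<and> A *v w1 = l *\<^sub>R w1 \<and> A *v w2 = inverse l *\<^sub>R w2 \<and>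
        area_form w1 w2 > 0 \<and> (let u = sym_monomial w1 w2 m in x = u /\<^sub>R sqrt (tensor_form u u)))"
    then obtain \<gamma> B l' w1 w2 and u :: "'k tensor" where \<gamma>: "\<gamma> \<in> carrier PSL2R"
      "(sym_rep {A, - A} :: 'k tensor \<Rightarrow> 'k tensor) = sym_rep \<gamma>" and B: "B \<in> \<gamma>"
      and l': "\<bar>l'\<bar> > \<bar>inverse l'\<bar>" and eig: "B *v w1 = l' *\<^sub>R w1" "B *v w2 = inverse l' *\<^sub>R w2"
      and w: "area_form w1 w2 > 0"
      and u: "u = sym_monomial w1 w2 m" and x: "x = u /\<^sub>R sqrt (tensor_form u u)"
      unfolding Let_def by blast
    have "\<gamma> = {A, - A}" using sym_rep_inj[OF ev carrier \<gamma>] by simp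
    then have "B = A \<or> B = - A" using B by auto
    then obtain s :: real where s: "s = 1 \<or> s = -1" "A *v z = s *\<^sub>R (B *v z)" for z
      by (metis matrix_vector_mult_uminus_left minus_minus scaleR_minus1_left scaleR_one)
    \<comment> \<open>Since \<open>inverse 0 = 0\<close>, the strict inequality \<open>l'\<close>
      also excludes the eigenvalue 0.\<close>
    have "\<bar>l'\<bar> > 1"
    proof (rule ccontr)
      assume "\<not> \<bar>l'\<bar> > 1"
      then have "l' = 0 \<or> \<bar>inverse l'\<bar> \<ge> 1" by (auto simp: one_le_inverse_iff)
      with l' \<open>\<not> \<bar>l'\<bar> > 1\<close> show False by auto
    qed
    \<comment> \<open>Both dominant eigenvalues exceed 1 in absolute value, so their product is not
      1, nor is that of their inverses; this makes \<open>w1\<close> parallel to \<open>v1\<close>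
      and \<open>w2\<close> to \<open>v2\<close>.\<close>
    then have big: "\<bar>l * (s * l')\<bar> > 1" "l \<noteq> 0" "l' \<noteq> 0"
      using A(4) s(1) less_1_mult[of "\<bar>l\<bar>" "\<bar>l'\<bar>"] by (auto simp: abs_mult)
    have "A *v w1 = (s * l') *\<^sub>R w1" "A *v w2 = (s * inverse l') *\<^sub>R w2"
      using s eig by simp_all
    moreover have "l * (s * l') \<noteq> 1" using big by auto
    moreover have "inverse l * (s * inverse l') \<noteq> 1"
      using big s(1) by (auto simp: field_simps)
    ultimately obtain a b where ab: "w1 = a *\<^sub>R v1" "w2 = b *\<^sub>R v2"
      using eigenvectors_parallel[OF A(1,2)] eigenvectors_parallel[OF A(1,3)] nz by metis
    have "0 < (a * b) * area_form v1 v2" using w by (simp add: ab mult_ac)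
    then have "a * b > 0" using v by (rule zero_less_mult_pos2)
    moreover have "sym_monomial w1 w2 m = (a * b) ^ m *\<^sub>R (sym_monomial v1 v2 m :: 'k tensor)"
      using m by (simp add: ab sym_monomial_scaleR power_mult_distrib)
    ultimately show "x = inverse (sqrt (real (2 * m choose m)) * area_form v1 v2 ^ m) *\<^sub>R
        (sym_monomial v1 v2 m :: 'k tensor)"
      unfolding x norm[OF w u] by (auto simp: ab power_mult_distrib zero_less_mult_iff field_simps)
  qed
qed

section \<open>The form evaluated on two neutral vectors\<close>

theorem proposition3p7:
  fixes n :: nat and \<gamma> \<eta> :: "(real^2^2) set" and t :: real
  assumes "n \<ge> 1" and "CARD('k::finite) = 4 * n - 2"
    and "\<gamma> \<in> carrier PSL2R" and "loxodromic \<gamma>"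
    and "\<eta> \<in> carrier PSL2R" and "loxodromic \<eta>"
    and "distinct [attracting \<gamma>, repelling \<gamma>, attracting \<eta>, repelling \<eta>]"
    and "t = cross_ratio (repelling \<eta>) (attracting \<eta>) (attracting \<gamma>) (repelling \<gamma>)"
  shows "tensor_form
      (neutral_vector n (sym_rep \<eta> :: 'k tensor \<Rightarrow> 'k tensor))
      (neutral_vector n (sym_rep \<gamma> :: 'k tensor \<Rightarrow> 'k tensor)) =
    1 / (t - 1) ^ (2 * n - 1) * (\<Sum>j = 0..2 * n - 1. real ((2 * n - 1) choose j) ^ 2 * t ^ j)"
proof -
  define m where "m = 2 * n - 1"
  have m: "odd m" "CARD('k) = 2 * m" using assms(1,2) by (auto simp: m_def)
  obtain A l v1 v2 where A: "\<eta> = {A, - A}" "det A = 1" "\<bar>l\<bar> > 1"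
    "A *v v1 = l *\<^sub>R v1" "A *v v2 = inverse l *\<^sub>R v2" and v: "area_form v1 v2 > 0"
    using loxodromic_eigenvectors[OF assms(5,6)] .
  obtain B k w1 w2 where B: "\<gamma> = {B, - B}" "det B = 1" "\<bar>k\<bar> > 1"
    "B *v w1 = k *\<^sub>R w1" "B *v w2 = inverse k *\<^sub>R w2" and w: "area_form w1 w2 > 0"
    using loxodromic_eigenvectors[OF assms(3,4)] .
  have nz: "v1 \<noteq> 0" "v2 \<noteq> 0" "w1 \<noteq> 0" "w2 \<noteq> 0"
    using area_form_nonzeroD[of v1 v2] area_form_nonzeroD[of w1 w2] v w by auto
  have fixed: "attracting \<eta> = proj_point v1" "repelling \<eta> = proj_point v2"
    "attracting \<gamma> = proj_point w1" "repelling \<gamma> = proj_point w2"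
    using attracting_eq[OF A(2,4,5,3)] repelling_eq[OF A(2,4,5,3)]
      attracting_eq[OF B(2,4,5,3)] repelling_eq[OF B(2,4,5,3)] v w A(1) B(1) by simp_all
  define P where "P = area_form v1 w1 * area_form v2 w2"
  define Q where "Q = area_form v1 w2 * area_form v2 w1"
  have D: "area_form v1 v2 * area_form w1 w2 = P - Q"
    by (simp add: P_def Q_def area_form_Pluecker[of v1 v2])
  have PQ: "P - Q \<noteq> 0" using v w by (simp flip: D)
  have "distinct [proj_point v2, proj_point v1, proj_point w1, proj_point w2]"
    using assms(7) unfolding fixed by auto
  \<comment> \<open>The factors of \<open>P\<close> are nonzero because the attracting points differ
    and the repelling points differ.\<close>
  then have P: "P \<noteq> 0" and "t = (area_form w1 v2 * area_form w2 v1) / (area_form w1 v1 * area_form w2 v2)"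
    unfolding assms(8) fixed by (auto simp: cross_ratio_proj_point nz proj_point_eq_iff P_def)
  \<comment> \<open>All four pairings are reversed, so the signs cancel.\<close>
  then have t: "t = Q / P"
    by (simp add: P_def Q_def area_form_commute[of _ v1] area_form_commute[of _ v2] mult_ac)
  define C where "C = real (2 * m choose m)"
  have C: "C > 0" by (simp add: C_def)
  have "tensor_form (neutral_vector n (sym_rep \<eta> :: 'k tensor \<Rightarrow> 'k tensor))
      (neutral_vector n (sym_rep \<gamma> :: 'k tensor \<Rightarrow> 'k tensor)) =
    inverse (sqrt C * area_form v1 v2 ^ m) * (inverse (sqrt C * area_form w1 w2 ^ m) *
      tensor_form (sym_monomial v1 v2 m :: 'k tensor) (sym_monomial w1 w2 m))"
    unfolding A(1) B(1) neutral_vector_eq[OF assms(1,2) A(2,4,5,3) v]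
      neutral_vector_eq[OF assms(1,2) B(2,4,5,3) w] m_def[symmetric] C_def[symmetric]
    by (simp only: bilinear_lmul[OF tensor_form_bilinear] bilinear_rmul[OF tensor_form_bilinear] real_scaleR_def mult.left_commute)
  also have "\<dots> = tensor_form (sym_monomial v1 v2 m :: 'k tensor) (sym_monomial w1 w2 m) / (C * (P - Q) ^ m)"
    using C by (simp add: field_simps flip: D)
  also have "\<dots> = - (\<Sum>j = 0..m. real (m choose j) ^ 2 * (P ^ (m - j) * Q ^ j)) / (P - Q) ^ m"
    using C unfolding tensor_form_sym_monomial[OF m(2)] P_def[symmetric] Q_def[symmetric] C_def[symmetric]
    by simp
  \<comment> \<open>The sum is homogeneous of degree \<open>m\<close> in \<open>P\<close> and
    \<open>Q\<close>.\<close>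
  also have "(\<Sum>j = 0..m. real (m choose j) ^ 2 * (P ^ (m - j) * Q ^ j)) =
      P ^ m * (\<Sum>j = 0..m. real (m choose j) ^ 2 * t ^ j)"
    unfolding sum_distrib_left using P
    by (intro sum.cong) (auto simp: t power_divide power_diff)
  \<comment> \<open>As \<open>m\<close> is odd, passing from \<open>1 - t\<close> to
    \<open>t - 1\<close> produces a sign that cancels the one of the form.\<close>
  also have "(P - Q) ^ m = - (P ^ m * (t - 1) ^ m)"
  proof -
    have "P - Q = - (P * (t - 1))" using P by (simp add: t field_simps)
    then show ?thesis using m by (simp add: power_mult_distrib)
  qed
  finally show ?thesis using P by (simp add: m_def)
qed

end
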